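(* Consider the system $$X_0(t)=0,\qquad \dot{X}_n(t)=k_{n-1}X_{n-1}^2(t)-k_nX_n(t)X_{n+1}(t)\quad (n\ge 1),\qquad k_n=2^n.$$ Given $t_0>0$ and an integer $n_0\ge0$, there exists a unique negative finite energy self-similar solution $X_n(t)=\frac{a_n}{t-t_0}$, defined on $[0,t_0)$, with $$a_1=\dots=a_{n_0}=0,\qquad a_{n_0+1}\ne0.$$ This solution blows up at time $t_0$.
   Context: Here a self-similar solution on $[0,t_0)$ is a solution of the form $X_n(t)=\frac{a_n}{t-t_0}$, $0\le t<t_0$, $n\ge1$, with real coefficients $a_n$ satisfying all equations of the system on $[0,t_0)$. It has finite energy if $\sum_{n\ge1}a_n^2<\infty$. It is negative if $X_n(t)\le0$ for all $n\ge1$ and $t\in[0,t_0)$ (equivalently $a_n\ge0$ for all $n$). Blow-up at $t_0$ means componentwise blow-up: $\lim_{t\to t_0^-}|X_n(t)|=+\infty$ for every $n>n_0$. *)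

theory Defs
  imports Complex_Main
begin

definition wavenumber :: "nat \<Rightarrow> real" where
  "wavenumber n = 2 ^ n"

text \<open>At the endpoint \<open>t = 0\<close> the derivative is one-sided.\<close>
definition dyadic_solution :: "real \<Rightarrow> (nat \<Rightarrow> real \<Rightarrow> real) \<Rightarrow> bool" where
  "dyadic_solution t\<^sub>0 X \<longleftrightarrow>
     (\<forall>t\<in>{0..<t\<^sub>0}. X 0 t = 0) \<and>
     (\<forall>n\<ge>1. \<forall>t\<in>{0..<t\<^sub>0}.
        (X n has_real_derivative
           wavenumber (n - 1) * (X (n - 1) t)\<^sup>2 - wavenumber n * X n t * X (n + 1) t)
        (at t within {0..<t\<^sub>0}))"

text \<open>The profile is extended to index \<open>0\<close>; for \<open>0 < t\<^sub>0\<close>, the equation \<open>X\<^sub>0 = 0\<close>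
  in \<^const>\<open>dyadic_solution\<close> forces the value there to be \<open>0\<close>.\<close>
definition self_similar :: "real \<Rightarrow> (nat \<Rightarrow> real) \<Rightarrow> nat \<Rightarrow> real \<Rightarrow> real" where
  "self_similar t\<^sub>0 a n t = a n / (t - t\<^sub>0)"

definition self_similar_solution :: "real \<Rightarrow> (nat \<Rightarrow> real) \<Rightarrow> bool" where
  "self_similar_solution t\<^sub>0 a \<longleftrightarrow> dyadic_solution t\<^sub>0 (self_similar t\<^sub>0 a)"

definition finite_energy :: "(nat \<Rightarrow> real) \<Rightarrow> bool" where
  "finite_energy a \<longleftrightarrow> summable (\<lambda>n. (a (Suc n))\<^sup>2)"

definition negative :: "real \<Rightarrow> (nat \<Rightarrow> real \<Rightarrow> real) \<Rightarrow> bool" where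
  "negative t\<^sub>0 X \<longleftrightarrow> (\<forall>n\<ge>1. \<forall>t\<in>{0..<t\<^sub>0}. X n t \<le> 0)"

definition blows_up :: "nat \<Rightarrow> real \<Rightarrow> (nat \<Rightarrow> real \<Rightarrow> real) \<Rightarrow> bool" where
  "blows_up n\<^sub>0 t\<^sub>0 X \<longleftrightarrow> (\<forall>n>n\<^sub>0. filterlim (\<lambda>t. \<bar>X n t\<bar>) at_top (at_left t\<^sub>0))"

end

theory Submission
  imports Defs
begin

text \<open>With \<open>m = n\<^sub>0 + 1\<close> and \<open>b j = 2 ^ m * a (m + j)\<close> the system becomes a recursion for \<open>b\<close> with
  \<open>b 1 = 1\<close> and the single parameter \<open>x = b 0 > 0\<close>; increasing \<open>x\<close> increases the even
  and decreases the odd entries.  The flux \<open>2 ^ j * (b j)\<^sup>2 * b (j + 1)\<close> is the energy of the entries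
  up to \<open>j\<close>, so finite energy pins \<open>b j\<close> between two multiples of \<open>2 powr (- j / 3)\<close>.
  Uniqueness: for two parameters, the quotient of the even entries moves away from \<open>1\<close>
  at each step and becomes unbounded, which contradicts these bounds.
  Existence: the ratios \<open>b (j + 1) / b j\<close> follow a perturbation of the decreasing, expanding map
  \<open>r \<mapsto> 1 / (2 * r\<^sup>2)\<close>, so a shooting argument with nested intervals gives an \<open>x\<close>
  for which they eventually all lie in \<open>{7 / 10..19 / 20}\<close>.\<close>

fun profile :: "real \<Rightarrow> nat \<Rightarrow> real" where
  "profile x 0 = x"
| "profile x (Suc 0) = 1"
| "profile x (Suc (Suc j)) = 1 / 2 ^ Suc j + (profile x j)\<^sup>2 / (2 * profile x (Suc j))"

lemma profile_pos:
  assumes "0 < x"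
  shows "0 < profile x j"
  using assms by (induction x j rule: profile.induct) (auto intro!: add_pos_pos divide_pos_pos)

text \<open>Multiplying the recursion for entry \<open>j + 2\<close> by
  \<open>2 ^ Suc j * (profile x (Suc j))\<^sup>2\<close> turns its last term into the flux at
  \<open>j\<close>, so each step adds exactly one square.\<close>

lemma profile_flux:
  assumes "0 < x"
  shows "2 ^ j * (profile x j)\<^sup>2 * profile x (Suc j) = (\<Sum>i\<le>j. (profile x i)\<^sup>2)"
proof (induction j)
  case (Suc j)
  have "profile x (Suc j) > 0" using profile_pos[OF assms] .
  then have "2 ^ Suc j * (profile x (Suc j))\<^sup>2 * profile x (Suc (Suc j))
      = (profile x (Suc j))\<^sup>2 + 2 ^ j * (profile x j)\<^sup>2 * profile x (Suc j)"
    by (simp add: field_simps power2_eq_square)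
  then show ?case using Suc by simp
qed simp

text \<open>Entry \<open>j + 2\<close> increases with entry \<open>j\<close> and decreases with
  entry \<open>j + 1\<close>, which varies the opposite way. Odd entries get only a weak inequality
  because entry \<open>1\<close> is constant.\<close>

lemma profile_alternating_mono:
  assumes "0 < x" "x < y"
  shows "(even j \<longrightarrow> profile x j < profile y j) \<and> (odd j \<longrightarrow> profile y j \<le> profile x j)"
  using assms
proof (induction x j rule: profile.induct)
  case (3 x j)
  have y: "0 < y" using 3 by simp
  note pos = profile_pos[OF \<open>0 < x\<close>] profile_pos[OF y]
  have "(profile x j)\<^sup>2 / (2 * profile x (Suc j)) < (profile y j)\<^sup>2 / (2 * profile y (Suc j))"
    if "even j"
    using 3 that pos by (intro frac_less) (auto intro!: power_strict_mono less_imp_le)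
  moreover have "(profile y j)\<^sup>2 / (2 * profile y (Suc j)) \<le> (profile x j)\<^sup>2 / (2 * profile x (Suc j))"
    if "odd j"
    using 3 that pos by (intro frac_le power_mono) (auto simp: less_imp_le)
  ultimately show ?case by simp
qed auto

section \<open>Bounds from finite energy and uniqueness of the parameter\<close>

text \<open>A too large value of \<open>2 ^ j * (b j) ^ 3\<close> forces \<open>b (j + 2) \<ge> b j\<close>, hence again a too large
  value at \<open>j + 2\<close>, and so \<open>b\<close> cannot tend to \<open>0\<close>.\<close>
lemma cube_bound_of_flux_bounds:
  fixes b :: "nat \<Rightarrow> real"
  assumes pos: "\<And>j. 0 < b j" and lim: "b \<longlonglongrightarrow> 0" and "0 < \<alpha>"
    and lower: "\<And>j. \<alpha> \<le> 2 ^ j * (b j)\<^sup>2 * b (Suc j)"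
    and upper: "\<And>j. 2 ^ j * (b j)\<^sup>2 * b (Suc j) \<le> \<beta>"
  shows "2 ^ j * b j ^ 3 \<le> 2 * \<beta>\<^sup>2 / \<alpha>"
proof (rule ccontr)
  assume large: "\<not> ?thesis"
  have \<beta>: "0 < \<beta>" using \<open>0 < \<alpha>\<close> lower[of 0] upper[of 0] by linarith
  have step: "b k \<le> b (k + 2)" if k: "2 * \<beta>\<^sup>2 / \<alpha> < 2 ^ k * b k ^ 3" for k
  proof -
    define u v w q where "u = b k" and "v = b (Suc k)" and "w = b (k + 2)" and "q = (2::real) ^ k"
    have p: "u > 0" "v > 0" "w > 0" "q > 0"
      using pos by (auto simp: u_def v_def w_def q_def)
    have 1: "q * u\<^sup>2 * v \<le> \<beta>" using upper[of k] by (simp add: u_def v_def q_def)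
    have 2: "\<alpha> \<le> 2 * q * v\<^sup>2 * w" using lower[of "Suc k"] by (simp add: v_def w_def q_def)
    have 3: "2 * \<beta>\<^sup>2 < \<alpha> * (q * u ^ 3)"
      using k \<open>0 < \<alpha>\<close> by (simp add: u_def q_def field_simps)
    \<comment> \<open>Twice the squared flux is \<open>2 * q * v\<^sup>2 * (q * u ^ 3) * u\<close>.
      Largeness of \<open>q * u ^ 3\<close> and the lower flux bound at the next index dominate it
      by the same positive factor times \<open>w\<close>.\<close>
    have "(q * u\<^sup>2 * v)\<^sup>2 \<le> \<beta>\<^sup>2" using 1 p by (intro power_mono) auto
    then have "2 * q * v\<^sup>2 * (q * u ^ 3) * u \<le> 2 * \<beta>\<^sup>2"
      by (simp add: power2_eq_square power3_eq_cube algebra_simps)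
    also have "\<dots> \<le> \<alpha> * (q * u ^ 3)" using 3 by simp
    also have "\<dots> \<le> (2 * q * v\<^sup>2 * w) * (q * u ^ 3)"
      using 2 p by (intro mult_right_mono) auto
    finally have "(2 * q * v\<^sup>2 * (q * u ^ 3)) * u \<le> (2 * q * v\<^sup>2 * (q * u ^ 3)) * w"
      by (simp add: algebra_simps)
    moreover have "0 < 2 * q * v\<^sup>2 * (q * u ^ 3)" using p by simp
    ultimately have "u \<le> w" by (rule mult_left_le_imp_le)
    then show ?thesis by (simp add: u_def w_def)
  qed
  have grow: "2 * \<beta>\<^sup>2 / \<alpha> < 2 ^ (j + 2 * i) * b (j + 2 * i) ^ 3 \<and> b j \<le> b (j + 2 * i)" for i
  proof (induction i)
    case 0
    then show ?case using large by simp
  next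
    case (Suc i)
    let ?k = "j + 2 * i"
    have le: "b ?k \<le> b (?k + 2)" using step Suc by blast
    have "2 ^ ?k * b ?k ^ 3 \<le> 2 ^ (?k + 2) * b (?k + 2) ^ 3"
      using le pos[of ?k] by (intro mult_mono power_mono power_increasing) auto
    then have "2 * \<beta>\<^sup>2 / \<alpha> < 2 ^ (?k + 2) * b (?k + 2) ^ 3 \<and> b j \<le> b (?k + 2)"
      using le Suc by linarith
    then show ?case by (simp only: mult_Suc_right add.assoc add.commute[of 2])
  qed
  have "strict_mono (\<lambda>i. j + 2 * i)" by (auto simp: strict_mono_def)
  then have "(\<lambda>i. b (j + 2 * i)) \<longlonglongrightarrow> 0"
    using LIMSEQ_subseq_LIMSEQ[OF lim] by (simp add: o_def)
  then have "b j \<le> 0"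
    using grow by (intro LIMSEQ_le_const) auto
  then show False using pos[of j] by simp
qed

text \<open>The flux lies between \<open>x\<^sup>2\<close>, the energy of entry \<open>0\<close>,
  and the total energy. This gives the upper cube bound, which together with the lower flux bound
  gives the lower one.\<close>

lemma profile_cube_bounds:
  assumes "0 < x" and sum: "summable (\<lambda>j. (profile x j)\<^sup>2)"
  obtains c C where "0 < c" "\<And>j. c \<le> 2 ^ j * profile x j ^ 3" "\<And>j. 2 ^ j * profile x j ^ 3 \<le> C"
proof -
  define E where "E = (\<Sum>j. (profile x j)\<^sup>2)"
  define C where "C = 2 * E\<^sup>2 / x\<^sup>2"
  let ?b = "profile x"
  note pos = profile_pos[OF \<open>0 < x\<close>]
  have lower: "x\<^sup>2 \<le> 2 ^ j * (?b j)\<^sup>2 * ?b (Suc j)" for j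
    unfolding profile_flux[OF \<open>0 < x\<close>]
    using member_le_sum[of 0 "{..j}" "\<lambda>i. (?b i)\<^sup>2"] by simp
  have upper: "2 ^ j * (?b j)\<^sup>2 * ?b (Suc j) \<le> E" for j
    unfolding profile_flux[OF \<open>0 < x\<close>] E_def by (intro sum_le_suminf sum) auto
  have "(\<lambda>j. (?b j)\<^sup>2) \<longlonglongrightarrow> 0" using sum by (rule summable_LIMSEQ_zero)
  then have lim: "?b \<longlonglongrightarrow> 0"
    using tendsto_real_sqrt[of "\<lambda>j. (?b j)\<^sup>2" 0 sequentially] pos by (simp add: less_imp_le)
  have C: "2 ^ j * ?b j ^ 3 \<le> C" for j
    unfolding C_def using \<open>0 < x\<close> by (intro cube_bound_of_flux_bounds pos lim lower upper) simp
  have "0 < C" by (rule less_le_trans[OF _ C[of 0]]) (use \<open>0 < x\<close> in simp)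
  \<comment> \<open>The cube of the flux \<open>q * u\<^sup>2 * v\<close> is
    \<open>(q * u ^ 3)\<^sup>2 * (q * v ^ 3)\<close>. The upper bound \<open>C\<close> on
    \<open>q * u ^ 3\<close> therefore leaves a lower bound on \<open>q * v ^ 3\<close>; the factor
    \<open>2\<close> comes from \<open>2 ^ Suc j\<close>.\<close>
  have c: "2 * x ^ 6 / C\<^sup>2 \<le> 2 ^ Suc j * ?b (Suc j) ^ 3" for j
  proof -
    define u v q where "u = ?b j" and "v = ?b (Suc j)" and "q = (2::real) ^ j"
    have p: "u > 0" "v > 0" "q > 0" using pos by (auto simp: u_def v_def q_def)
    have "(q * u ^ 3)\<^sup>2 \<le> C\<^sup>2" using C[of j] p by (intro power_mono) (auto simp: u_def q_def)
    then have "(q * u ^ 3)\<^sup>2 * (q * v ^ 3) \<le> C\<^sup>2 * (q * v ^ 3)"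
      using p by (intro mult_right_mono) auto
    moreover have "(x\<^sup>2) ^ 3 \<le> (q * u\<^sup>2 * v) ^ 3"
      using lower[of j] by (intro power_mono) (auto simp: u_def v_def q_def)
    ultimately have "x ^ 6 \<le> C\<^sup>2 * (q * v ^ 3)"
      by (simp add: power_mult_distrib flip: power_mult)
         (simp add: power2_eq_square power3_eq_cube eval_nat_numeral algebra_simps)
    then show ?thesis using \<open>0 < C\<close> by (simp add: v_def q_def field_simps)
  qed
  \<comment> \<open>The term \<open>x ^ 3\<close> serves index \<open>0\<close>, which has no
    predecessor.\<close>
  show thesis
  proof (rule that[of "min (x ^ 3) (2 * x ^ 6 / C\<^sup>2)" C])
    show "0 < min (x ^ 3) (2 * x ^ 6 / C\<^sup>2)" using \<open>0 < x\<close> \<open>0 < C\<close> by simp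
    show "min (x ^ 3) (2 * x ^ 6 / C\<^sup>2) \<le> 2 ^ j * ?b j ^ 3" for j
      using c by (cases j) (auto simp: min_le_iff_disj)
  qed (rule C)
qed

text \<open>Used in both directions, this identifies any two admissible parameters. The excess of
  the even quotient over \<open>1\<close> gains a fixed amount at every second index, while the cube
  bounds keep the quotient bounded.\<close>

lemma profile_summable_imp_le:
  assumes "0 < x" and sum_x: "summable (\<lambda>j. (profile x j)\<^sup>2)"
    and sum_y: "summable (\<lambda>j. (profile y j)\<^sup>2)"
  shows "y \<le> x"
proof (rule ccontr)
  assume "\<not> y \<le> x"
  then have "x < y" "0 < y" using \<open>0 < x\<close> by auto
  note pos = profile_pos[OF \<open>0 < x\<close>] profile_pos[OF \<open>0 < y\<close>]
  note mono = profile_alternating_mono[OF \<open>0 < x\<close> \<open>x < y\<close>]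
  obtain c where c: "0 < c" "\<And>j. c \<le> 2 ^ j * profile x j ^ 3"
    using profile_cube_bounds[OF \<open>0 < x\<close> sum_x] by metis
  obtain C where C: "\<And>j. 2 ^ j * profile y j ^ 3 \<le> C"
    using profile_cube_bounds[OF \<open>0 < y\<close> sum_y] by metis
  define e where "e j = profile y j / profile x j" for j
  have e_bound: "e j ^ 3 \<le> C / c" for j
  proof -
    have "e j ^ 3 = (2 ^ j * profile y j ^ 3) / (2 ^ j * profile x j ^ 3)"
      by (simp add: e_def power_divide)
    also have "\<dots> \<le> C / c"
    proof (rule frac_le)
      have "0 \<le> 2 ^ j * profile y j ^ 3" using pos(2)[of j] by simp
      then show "0 \<le> C" using C[of j] by linarith
    qed (use C c in auto)
    finally show ?thesis .
  qed
  \<comment> \<open>The comparison \<open>(1 / q) ^ 3 \<le> c / (4 * q)\<close> below amounts to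
    \<open>4 / c \<le> q\<^sup>2\<close>, so \<open>32 / c\<close> is ample.\<close>
  obtain J where J: "32 / c < 4 ^ J"
    using real_arch_pow[of 4 "32 / c"] by auto
  \<comment> \<open>Eventually the inhomogeneous term \<open>1 / 2 ^ Suc j\<close> is at most half of \<open>profile x (j + 2)\<close>.\<close>
  have half: "profile x (j + 2) / 2 \<le> (profile x j)\<^sup>2 / (2 * profile x (Suc j))" if "J \<le> j" for j
  proof -
    define q where "q = (2::real) ^ j"
    have "q > 0" by (simp add: q_def)
    have "32 / c < q\<^sup>2"
    proof -
      have "(4::real) ^ J \<le> 4 ^ j" using that by (intro power_increasing) auto
      also have "\<dots> = q\<^sup>2" by (simp add: q_def power_mult[symmetric] mult.commute[of j] power_mult)
      finally show ?thesis using J by simp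
    qed
    then have "(1 / q) ^ 3 \<le> c / (4 * q)"
      using \<open>0 < c\<close> \<open>q > 0\<close> by (simp add: field_simps power2_eq_square power3_eq_cube)
    also have "\<dots> \<le> profile x (j + 2) ^ 3"
      using c(2)[of "j + 2"] \<open>q > 0\<close> by (simp add: field_simps q_def)
    finally have "1 / q \<le> profile x (j + 2)"
      using pos(1)[of "j + 2"] \<open>q > 0\<close> power_mono_iff[of "1 / q" "profile x (j + 2)" 3]
      by (simp add: less_imp_le del: profile.simps add_2_eq_Suc')
    moreover have "profile x (j + 2) = 1 / (2 * q) + (profile x j)\<^sup>2 / (2 * profile x (Suc j))"
      by (simp add: q_def)
    ultimately show ?thesis by (simp del: profile.simps add_2_eq_Suc')
  qed
  \<comment> \<open>The left side equals \<open>((e j)\<^sup>2 - 1) / 2\<close>. The inhomogeneous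
    terms cancel in the difference of the two profiles, the odd denominator is smaller for
    \<open>y\<close>, and \<open>half\<close> supplies the factor \<open>1 / 2\<close>.\<close>
  have step: "e j - 1 + (e j - 1)\<^sup>2 / 2 \<le> e (j + 2) - 1" if "J \<le> j" "even j" for j
  proof -
    let ?p = "(profile x j)\<^sup>2 / (2 * profile x (Suc j))"
    have "(profile y j)\<^sup>2 / (2 * profile x (Suc j)) \<le> (profile y j)\<^sup>2 / (2 * profile y (Suc j))"
      using mono[of "Suc j"] that pos by (intro divide_left_mono) auto
    then have "((e j)\<^sup>2 - 1) * ?p \<le> profile y (j + 2) - profile x (j + 2)"
      using pos(1)[of j] by (simp add: e_def power_divide algebra_simps)
    moreover have "1 \<le> e j" using mono[of j] that pos by (simp add: e_def)
    then have "((e j)\<^sup>2 - 1) * (profile x (j + 2) / 2) \<le> ((e j)\<^sup>2 - 1) * ?p"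
      using half[OF \<open>J \<le> j\<close>] by (intro mult_left_mono) auto
    ultimately have "((e j)\<^sup>2 - 1) / 2 * profile x (j + 2) \<le> profile y (j + 2) - profile x (j + 2)"
      by simp
    then have "((e j)\<^sup>2 - 1) / 2 \<le> (profile y (j + 2) - profile x (j + 2)) / profile x (j + 2)"
      using pos(1)[of "j + 2"] pos_le_divide_eq by blast
    also have "\<dots> = e (j + 2) - 1" using pos(1)[of "j + 2"]
      by (simp add: e_def diff_divide_distrib del: profile.simps add_2_eq_Suc')
    finally show ?thesis by (simp add: power2_eq_square field_simps)
  qed
  define w where "w = e (2 * J) - 1"
  have "0 < w" using mono[of "2 * J"] pos by (simp add: w_def e_def)
  have grow: "w + real i * (w\<^sup>2 / 2) \<le> e (2 * J + 2 * i) - 1" for i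
  proof (induction i)
    case (Suc i)
    have "w \<le> e (2 * J + 2 * i) - 1"
      using Suc by (rule order_trans[rotated]) simp
    then have "w\<^sup>2 \<le> (e (2 * J + 2 * i) - 1)\<^sup>2" using \<open>0 < w\<close> by (intro power_mono) auto
    moreover have "real (Suc i) * (w\<^sup>2 / 2) = real i * (w\<^sup>2 / 2) + w\<^sup>2 / 2"
      by (simp add: algebra_simps add_divide_distrib)
    moreover have "e (2 * J + 2 * i) - 1 + (e (2 * J + 2 * i) - 1)\<^sup>2 / 2
        \<le> e (2 * J + 2 * i + 2) - 1"
      by (rule step) auto
    ultimately have "w + real (Suc i) * (w\<^sup>2 / 2) \<le> e (2 * J + 2 * i + 2) - 1"
      using Suc by linarith
    then show ?case by (simp only: mult_Suc_right add.assoc add.commute[of 2])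
  qed (simp add: w_def)
  \<comment> \<open>The \<open>1\<close> in the maximum ensures that the quotient is at most its
    cube, to which \<open>e_bound\<close> applies.\<close>
  obtain i where i: "max 1 (C / c) < real i * (w\<^sup>2 / 2)"
    using reals_Archimedean3[of "w\<^sup>2 / 2"] \<open>0 < w\<close> by auto
  let ?e = "e (2 * J + 2 * i)"
  have "max 1 (C / c) < ?e" using grow[of i] i \<open>0 < w\<close> by linarith
  moreover have "?e \<le> ?e ^ 3" using calculation by (intro self_le_power) auto
  ultimately show False using e_bound[of "2 * J + 2 * i"] by simp
qed

section \<open>Shooting by nested crossing intervals\<close>

text \<open>Take \<open>u'\<close> as the first point where \<open>g\<close> reaches
  \<open>d\<close>, and \<open>l'\<close> as the last point up to \<open>u'\<close> where
  \<open>g\<close> is at most \<open>c\<close>. Extremality confines \<open>g\<close> in between,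
  and the intermediate value theorem makes the end values exact.\<close>

lemma crossing_subinterval_incr:
  fixes g :: "real \<Rightarrow> real"
  assumes "l \<le> u" and cont: "continuous_on {l..u} g" and "c < d" "g l \<le> c" "d \<le> g u"
  obtains l' u' where "l \<le> l'" "l' \<le> u'" "u' \<le> u" "g l' = c" "g u' = d"
    "\<And>x. x \<in> {l'..u'} \<Longrightarrow> g x \<in> {c..d}"
proof -
  have preimage_compact: "compact (g -` B \<inter> {l..u})" if "closed B" for B
  proof -
    have "closed (g -` B \<inter> {l..u})" using cont that by (simp add: continuous_on_closed_vimage)
    then have "compact ({l..u} \<inter> (g -` B \<inter> {l..u}))" by (intro compact_Int_closed) auto
    then show ?thesis by (simp add: Int_absorb1)
  qed
  have "compact (g -` {d..} \<inter> {l..u})" by (rule preimage_compact) simp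
  moreover have "u \<in> g -` {d..} \<inter> {l..u}" using assms by simp
  ultimately obtain u' where u': "u' \<in> g -` {d..} \<inter> {l..u}"
    and u'_le: "\<And>x. x \<in> g -` {d..} \<inter> {l..u} \<Longrightarrow> u' \<le> x"
    by (metis compact_attains_inf empty_iff)
  have "continuous_on {l..u'} g" using cont u' by (auto intro: continuous_on_subset)
  then obtain z where "l \<le> z" "z \<le> u'" "g z = d"
    using IVT'[of g l d u'] u' assms by auto
  then have gu': "g u' = d" using u'_le[of z] u' by force
  have "compact (g -` {..c} \<inter> {l..u} \<inter> {..u'})"
    by (intro compact_Int_closed preimage_compact) auto
  moreover have "l \<in> g -` {..c} \<inter> {l..u} \<inter> {..u'}" using assms u' by simp
  ultimately obtain l' where l': "l' \<in> g -` {..c} \<inter> {l..u} \<inter> {..u'}"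
    and le_l': "\<And>x. x \<in> g -` {..c} \<inter> {l..u} \<inter> {..u'} \<Longrightarrow> x \<le> l'"
    by (metis compact_attains_sup empty_iff)
  have "continuous_on {l'..u'} g" using cont u' l' by (auto intro: continuous_on_subset)
  then obtain z where "l' \<le> z" "z \<le> u'" "g z = c"
    using IVT'[of g l' c u'] u' l' gu' \<open>c < d\<close> by auto
  then have gl': "g l' = c" using le_l'[of z] u' l' by force
  show thesis
  proof (rule that[of l' u'])
    show "g x \<in> {c..d}" if "x \<in> {l'..u'}" for x
    proof -
      have "x \<in> {l..u}" using that u' l' by auto
      then have "g x \<le> d" using u'_le[of x] gu' that by (cases "d \<le> g x") auto
      moreover have "c \<le> g x"
        using le_l'[of x] gl' that \<open>x \<in> {l..u}\<close> by (cases "g x \<le> c") auto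
      ultimately show ?thesis by simp
    qed
  qed (use u' l' gu' gl' in auto)
qed

lemma crossing_subinterval:
  fixes g :: "real \<Rightarrow> real"
  assumes "l \<le> u" and cont: "continuous_on {l..u} g" and "c < d"
    and cross: "g l \<le> c \<and> d \<le> g u \<or> d \<le> g l \<and> g u \<le> c"
  obtains l' u' where "l \<le> l'" "l' \<le> u'" "u' \<le> u"
    "g l' = c \<and> g u' = d \<or> g l' = d \<and> g u' = c"
    "\<And>x. x \<in> {l'..u'} \<Longrightarrow> g x \<in> {c..d}"
  using cross
proof
  assume "g l \<le> c \<and> d \<le> g u"
  then show thesis
    using crossing_subinterval_incr[OF \<open>l \<le> u\<close> cont \<open>c < d\<close>] that by metis
next
  assume "d \<le> g l \<and> g u \<le> c"
  then obtain l' u' where "l \<le> l'" "l' \<le> u'" "u' \<le> u" "- g l' = - d" "- g u' = - c"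
    and "\<And>x. x \<in> {l'..u'} \<Longrightarrow> - g x \<in> {- d..- c}"
    using crossing_subinterval_incr[OF \<open>l \<le> u\<close> continuous_on_minus[OF cont], of "- d" "- c"] \<open>c < d\<close>
    by auto
  then show thesis using that[of l' u'] by force
qed

text \<open>Reaching one end of the window at stage \<open>i\<close> overshoots the opposite end at stage
  \<open>i + 1\<close>, so that a nested sequence of crossing intervals exists.\<close>
lemma common_window_point:
  fixes g :: "nat \<Rightarrow> real \<Rightarrow> real" and c d :: "nat \<Rightarrow> real"
  assumes "l \<le> u" and cont: "\<And>i. continuous_on {l..u} (g i)" and cd: "\<And>i. c i < d i"
    and start: "g 0 l \<le> c 0" "d 0 \<le> g 0 u"
    and low: "\<And>i x. x \<in> {l..u} \<Longrightarrow> \<forall>k\<le>i. g k x \<in> {c k..d k} \<Longrightarrow> g i x = c i \<Longrightarrow>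
      d (Suc i) \<le> g (Suc i) x"
    and up: "\<And>i x. x \<in> {l..u} \<Longrightarrow> \<forall>k\<le>i. g k x \<in> {c k..d k} \<Longrightarrow> g i x = d i \<Longrightarrow>
      g (Suc i) x \<le> c (Suc i)"
  obtains x where "x \<in> {l..u}" "\<And>i. g i x \<in> {c i..d i}"
proof -
  \<comment> \<open>The orientation may flip from stage to stage, hence the disjunction. Recording
    the windows of all stages up to \<open>i\<close> replaces an explicit nesting of the
    intervals.\<close>
  have interval: "\<exists>l' u'. l \<le> l' \<and> l' \<le> u' \<and> u' \<le> u \<and>
    (g i l' = c i \<and> g i u' = d i \<or> g i l' = d i \<and> g i u' = c i) \<and>
    (\<forall>x\<in>{l'..u'}. \<forall>k\<le>i. g k x \<in> {c k..d k})" for i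
  proof (induction i)
    case 0
    obtain l' u' where "l \<le> l'" "l' \<le> u'" "u' \<le> u" "g 0 l' = c 0" "g 0 u' = d 0"
      "\<And>x. x \<in> {l'..u'} \<Longrightarrow> g 0 x \<in> {c 0..d 0}"
      using crossing_subinterval_incr[OF \<open>l \<le> u\<close> cont cd start] by blast
    then show ?case by (intro exI[of _ l'] exI[of _ u']) auto
  next
    case (Suc i)
    then obtain l' u' where lu: "l \<le> l'" "l' \<le> u'" "u' \<le> u"
      and ends: "g i l' = c i \<and> g i u' = d i \<or> g i l' = d i \<and> g i u' = c i"
      and window: "\<forall>x\<in>{l'..u'}. \<forall>k\<le>i. g k x \<in> {c k..d k}"
      by blast
    have l'u': "l' \<in> {l..u}" "u' \<in> {l..u}" "l' \<in> {l'..u'}" "u' \<in> {l'..u'}" using lu by auto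
    have "g (Suc i) l' \<le> c (Suc i) \<and> d (Suc i) \<le> g (Suc i) u' \<or>
        d (Suc i) \<le> g (Suc i) l' \<and> g (Suc i) u' \<le> c (Suc i)"
      using ends low[OF l'u'(1)] up[OF l'u'(1)] low[OF l'u'(2)] up[OF l'u'(2)] window l'u' by blast
    moreover have "continuous_on {l'..u'} (g (Suc i))"
      using lu by (intro continuous_on_subset[OF cont]) auto
    ultimately obtain l'' u'' where lu'': "l' \<le> l''" "l'' \<le> u''" "u'' \<le> u'"
      and ends'': "g (Suc i) l'' = c (Suc i) \<and> g (Suc i) u'' = d (Suc i) \<or>
        g (Suc i) l'' = d (Suc i) \<and> g (Suc i) u'' = c (Suc i)"
      and window'': "\<And>x. x \<in> {l''..u''} \<Longrightarrow> g (Suc i) x \<in> {c (Suc i)..d (Suc i)}"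
      using crossing_subinterval[OF \<open>l' \<le> u'\<close> _ cd] by metis
    have "\<forall>x\<in>{l''..u''}. \<forall>k\<le>Suc i. g k x \<in> {c k..d k}"
      using window window'' lu'' by (auto simp: le_Suc_eq)
    then show ?case using lu lu'' ends'' by (intro exI[of _ l''] exI[of _ u'']) auto
  qed
  \<comment> \<open>By compactness finitely many windows suffice, and the interval of their largest
    stage meets them all.\<close>
  have "{l..u} \<inter> (\<Inter>i\<in>UNIV. g i -` {c i..d i} \<inter> {l..u}) \<noteq> {}"
  proof (rule compact_imp_fip_image)
    show "closed (g i -` {c i..d i} \<inter> {l..u})" for i
      using cont[of i] by (simp add: continuous_on_closed_vimage)
    show "{l..u} \<inter> (\<Inter>i\<in>I. g i -` {c i..d i} \<inter> {l..u}) \<noteq> {}" if I: "finite I" for I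
    proof -
      obtain N where N: "\<And>i. i \<in> I \<Longrightarrow> i \<le> N"
        using I finite_nat_set_iff_bounded_le by auto
      obtain l' u' where "l \<le> l'" "l' \<le> u'" "u' \<le> u"
        and "\<forall>x\<in>{l'..u'}. \<forall>k\<le>N. g k x \<in> {c k..d k}"
        using interval[of N] by blast
      then have "l' \<in> {l..u} \<inter> (\<Inter>i\<in>I. g i -` {c i..d i} \<inter> {l..u})"
        using N by auto
      then show ?thesis by blast
    qed
  qed simp
  then obtain x where "x \<in> {l..u} \<inter> (\<Inter>i\<in>UNIV. g i -` {c i..d i} \<inter> {l..u})" by blast
  then show thesis using that[of x] by simp
qed

section \<open>Existence of a summable profile\<close>

lemma continuous_on_profile: "continuous_on {0<..} (\<lambda>x. profile x j)"
proof (induction j rule: induct_nat_012)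
  case (ge2 j)
  have "continuous_on {0<..} (\<lambda>x. 1 / 2 ^ Suc j + (profile x j)\<^sup>2 / (2 * profile x (Suc j)))"
    using ge2 profile_pos by (intro continuous_intros) (auto simp: less_imp_neq[symmetric])
  then show ?case by simp
qed (auto intro: continuous_intros)

lemma profile_ratio_rec:
  assumes "0 < x"
  shows "profile x (i + 3) / profile x (i + 2) =
    1 / (2 ^ (i + 2) * profile x (i + 2)) + 1 / (2 * (profile x (i + 2) / profile x (Suc i))\<^sup>2)"
proof -
  have "profile x (i + 3) = 1 / 2 ^ (i + 2) + (profile x (Suc i))\<^sup>2 / (2 * profile x (i + 2))"
    by (simp add: numeral_3_eq_3)
  moreover have "profile x (i + 2) > 0" "profile x (Suc i) > 0" using profile_pos[OF assms] by blast+
  ultimately show ?thesis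
    by (simp add: add_divide_distrib power_divide power2_eq_square del: profile.simps add_2_eq_Suc')
qed

text \<open>The ratios telescope down to entry \<open>1\<close>, which is \<open>1\<close>. With
  \<open>r = 7 / 10\<close> this makes the perturbation in \<open>profile_ratio_rec\<close> decay
  like \<open>(5 / 7) ^ i\<close>.\<close>

lemma profile_ge_power:
  assumes "0 < x" "0 < r" and "\<And>k. k < n \<Longrightarrow> r \<le> profile x (k + 2) / profile x (Suc k)"
  shows "r ^ n \<le> profile x (Suc n)"
  using assms(3)
proof (induction n)
  case (Suc n)
  have "r ^ Suc n \<le> r * profile x (Suc n)" using Suc \<open>0 < r\<close> by (simp del: profile.simps)
  also have "\<dots> \<le> profile x (Suc (Suc n))"
    using Suc.prems[of n] profile_pos[OF \<open>0 < x\<close>, of "Suc n"]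
    by (simp add: pos_le_divide_eq del: profile.simps)
  finally show ?case .
qed simp

text \<open>The unperturbed ratio map has the repelling fixed point \<open>2 powr (- 1 / 3)\<close>,
  about \<open>0.79\<close>, inside the windows. Upper ends below \<open>1\<close> from stage
  \<open>2\<close> on give geometric decay.\<close>

lemma summable_profile_exists: "\<exists>x>0. summable (\<lambda>j. (profile x j)\<^sup>2)"
proof -
  define g where "g i x = profile x (i + 2) / profile x (Suc i)" for i x
  \<comment> \<open>The first two upper ends are larger to absorb the perturbation, which is not yet
    small there.\<close>
  define d :: "nat \<Rightarrow> real" where
    "d i = (if i = 0 then 21 / 20 else if i = 1 then 1 else 19 / 20)" for i
  \<comment> \<open>Chosen so that \<open>g 0 x = (1 + x\<^sup>2) / 2\<close> covers exactly its window \<open>{7 / 10..d 0}\<close>.\<close>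
  define l u :: real where "l = sqrt (2 / 5)" and "u = sqrt (11 / 10)"
  have "0 < l" by (simp add: l_def)
  then have pos: "0 < profile x j" if "x \<in> {l..u}" for x j
    using that by (intro profile_pos) simp
  have g_Suc: "g (Suc i) x = 1 / (2 ^ (i + 2) * profile x (i + 2)) + 1 / (2 * (g i x)\<^sup>2)"
    if "x \<in> {l..u}" for i x
    using profile_ratio_rec[of x i] that \<open>0 < l\<close> by (simp add: g_def numeral_3_eq_3 del: profile.simps)
  obtain x where x: "x \<in> {l..u}" and window: "\<And>i. g i x \<in> {7 / 10..d i}"
  proof (rule common_window_point[of l u g "\<lambda>_. 7 / 10" d])
    show "continuous_on {l..u} (g i)" for i
    proof -
      have "continuous_on {l..u} (\<lambda>x. profile x j)" for j
        using \<open>0 < l\<close> by (intro continuous_on_subset[OF continuous_on_profile]) auto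
      then show ?thesis
        unfolding g_def using pos
        by (intro continuous_intros) (auto simp: less_imp_neq[symmetric] simp del: profile.simps add_2_eq_Suc')
    qed
    \<comment> \<open>The unperturbed map sends \<open>7 / 10\<close> to \<open>50 / 49\<close>,
      above every upper end after the first, and the perturbation is positive.\<close>
    show "d (Suc i) \<le> g (Suc i) x" if "x \<in> {l..u}" "g i x = 7 / 10" for i x
    proof -
      have "d (Suc i) \<le> 1 / (2 * (7 / 10)\<^sup>2)" by (simp add: d_def power2_eq_square)
      also have "\<dots> \<le> g (Suc i) x"
        unfolding g_Suc[OF that(1)] that(2) using pos[OF that(1), of "i + 2"] by simp
      finally show ?thesis .
    qed
    show "g (Suc i) x \<le> 7 / 10"
      if x: "x \<in> {l..u}" and window: "\<forall>k\<le>i. g k x \<in> {7 / 10..d k}" and gi: "g i x = d i" for i x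
    proof -
      have "0 < d i" by (simp add: d_def)
      have "(7 / 10) ^ i \<le> profile x (Suc i)"
        using x \<open>0 < l\<close> window by (intro profile_ge_power) (auto simp: g_def)
      then have "d i * (7 / 10) ^ i \<le> d i * profile x (Suc i)"
        using \<open>0 < d i\<close> by simp
      also have "\<dots> = profile x (i + 2)"
        using pos[OF x, of "Suc i"] gi by (simp add: g_def field_simps del: profile.simps)
      finally have "2 ^ (i + 2) * (d i * (7 / 10) ^ i) \<le> 2 ^ (i + 2) * profile x (i + 2)" by simp
      moreover have "2 ^ (i + 2) * (d i * (7 / 10) ^ i) = 4 * d i * (7 / 5) ^ i"
      proof -
        have "(7 / 5 :: real) ^ i = 2 ^ i * (7 / 10) ^ i" by (simp flip: power_mult_distrib)
        then show ?thesis by simp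
      qed
      ultimately have "1 / (2 ^ (i + 2) * profile x (i + 2)) \<le> 1 / (4 * d i * (7 / 5) ^ i)"
        using \<open>0 < d i\<close> by (intro divide_left_mono) (auto intro!: mult_pos_pos pos[OF x] simp del: profile.simps add_2_eq_Suc')
      then have "g (Suc i) x \<le> 1 / (4 * d i * (7 / 5) ^ i) + 1 / (2 * (d i)\<^sup>2)"
        unfolding g_Suc[OF x] gi by simp
      also have "\<dots> \<le> 7 / 10"
      proof -
        \<comment> \<open>From stage \<open>2\<close> on \<open>d i\<close> is constant and the
          perturbation bound is largest at \<open>i = 2\<close>, so three numerical checks
          remain.\<close>
        consider "i = 0" | "i = 1" | "2 \<le> i" by linarith
        then show ?thesis
        proof cases
          case 3
          then have "(7 / 5) ^ 2 \<le> (7 / 5 :: real) ^ i" by (intro power_increasing) auto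
          then have "1 / (4 * (19 / 20) * (7 / 5) ^ i) \<le> 1 / (4 * (19 / 20) * (7 / 5 :: real) ^ 2)"
            by (intro divide_left_mono mult_left_mono) auto
          then show ?thesis using 3 by (simp add: d_def power2_eq_square)
        qed (simp_all add: d_def power2_eq_square)
      qed
      finally show ?thesis .
    qed
  qed (auto simp: d_def l_def u_def g_def numeral_2_eq_2)
  have "summable (\<lambda>j. (profile x j)\<^sup>2)"
  proof (rule summable_ratio_test)
    \<comment> \<open>The quotient of entries \<open>Suc n\<close> and \<open>n\<close> is
      \<open>g (n - 1) x\<close>, so \<open>3 \<le> n\<close> puts it in a window with upper end
      \<open>19 / 20\<close>.\<close>
    show "norm ((profile x (Suc n))\<^sup>2) \<le> (19 / 20)\<^sup>2 * norm ((profile x n)\<^sup>2)" if "3 \<le> n" for n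
    proof -
      obtain i where n: "n = Suc i" using \<open>3 \<le> n\<close> by (cases n) auto
      then have "2 \<le> i" using that by simp
      have "profile x (i + 2) \<le> 19 / 20 * profile x (Suc i)"
        using window[of i] \<open>2 \<le> i\<close> pos[OF x, of "Suc i"]
        by (simp add: g_def d_def pos_divide_le_eq del: profile.simps)
      then have "(profile x (i + 2))\<^sup>2 \<le> (19 / 20)\<^sup>2 * (profile x (Suc i))\<^sup>2"
        unfolding power_mult_distrib[symmetric]
        using less_imp_le[OF pos[OF x, of "i + 2"]] by (rule power_mono)
      then show ?thesis by (simp add: n del: profile.simps)
    qed
  qed (simp add: power2_eq_square)
  then show ?thesis using x \<open>0 < l\<close> by (intro exI[of _ x]) auto
qed

section \<open>Profiles and self-similar solutions\<close>

definition shifted_profile :: "nat \<Rightarrow> real \<Rightarrow> nat \<Rightarrow> real" where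
  "shifted_profile m x n = (if n < m then 0 else profile x (n - m) / 2 ^ m)"

text \<open>Both sides of each differential equation are constants over
  \<open>(t - t\<^sub>0)\<^sup>2\<close>, so one time decides all times. The relation stays free of
  division because entries may vanish.\<close>

lemma self_similar_solution_iff:
  assumes "0 < t\<^sub>0"
  shows "self_similar_solution t\<^sub>0 a \<longleftrightarrow>
    a 0 = 0 \<and> (\<forall>n. 2 ^ Suc n * a (Suc n) * a (n + 2) = a (Suc n) + 2 ^ n * (a n)\<^sup>2)"
proof -
  let ?X = "self_similar t\<^sub>0 a"
  let ?rhs = "\<lambda>n t. 2 ^ n * (?X n t)\<^sup>2 - 2 ^ Suc n * ?X (Suc n) t * ?X (Suc n + 1) t"
  have deriv: "(?X n has_real_derivative - a n / (t - t\<^sub>0)\<^sup>2) (at t within S)" if "t < t\<^sub>0" for n t S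
    unfolding self_similar_def using that
    by (auto intro!: derivative_eq_intros simp: power2_eq_square)
  have rhs_eq: "- a (Suc n) / (t - t\<^sub>0)\<^sup>2 = ?rhs n t \<longleftrightarrow>
      2 ^ Suc n * a (Suc n) * a (n + 2) = a (Suc n) + 2 ^ n * (a n)\<^sup>2" if "t < t\<^sub>0" for n t
  proof -
    have "?rhs n t = (2 ^ n * (a n)\<^sup>2 - 2 ^ Suc n * a (Suc n) * a (n + 2)) / (t - t\<^sub>0)\<^sup>2"
      by (simp add: self_similar_def power_divide power2_eq_square diff_divide_distrib)
    moreover have "- a (Suc n) / s = (2 ^ n * (a n)\<^sup>2 - 2 ^ Suc n * a (Suc n) * a (n + 2)) / s \<longleftrightarrow>
        2 ^ Suc n * a (Suc n) * a (n + 2) = a (Suc n) + 2 ^ n * (a n)\<^sup>2" if "s \<noteq> 0" for s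
      unfolding divide_cancel_right using that by linarith
    ultimately show ?thesis using that by simp
  qed
  have ode: "(\<forall>t\<in>{0..<t\<^sub>0}. (?X (Suc n) has_real_derivative ?rhs n t) (at t within {0..<t\<^sub>0})) \<longleftrightarrow>
      2 ^ Suc n * a (Suc n) * a (n + 2) = a (Suc n) + 2 ^ n * (a n)\<^sup>2" (is "?L \<longleftrightarrow> ?R") for n
  proof
    assume ?L
    \<comment> \<open>An interior time makes the derivative two-sided, hence unique.\<close>
    define t where "t = t\<^sub>0 / 2"
    have t: "t \<in> {0<..<t\<^sub>0}" using assms by (simp add: t_def)
    then have "(?X (Suc n) has_real_derivative ?rhs n t) (at t within {0<..<t\<^sub>0})"
      using \<open>?L\<close> by (auto intro: has_field_derivative_subset[of _ _ _ "{0..<t\<^sub>0}"])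
    then have "(?X (Suc n) has_real_derivative ?rhs n t) (at t)"
      unfolding at_within_open[OF t open_greaterThanLessThan] .
    moreover have "t < t\<^sub>0" using t by simp
    ultimately show ?R using DERIV_unique[OF deriv] rhs_eq by blast
  next
    assume ?R
    show ?L
    proof
      fix t assume "t \<in> {0..<t\<^sub>0}"
      then have "t < t\<^sub>0" by simp
      show "(?X (Suc n) has_real_derivative ?rhs n t) (at t within {0..<t\<^sub>0})"
        using deriv[OF \<open>t < t\<^sub>0\<close>, of "Suc n"] iffD2[OF rhs_eq[OF \<open>t < t\<^sub>0\<close>] \<open>?R\<close>] by (rule back_subst)
    qed
  qed
  have zero: "(\<forall>t\<in>{0..<t\<^sub>0}. ?X 0 t = 0) \<longleftrightarrow> a 0 = 0"
    using assms by (auto simp: self_similar_def)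
  have shift: "(\<forall>n\<ge>1. Q n) \<longleftrightarrow> (\<forall>n. Q (Suc n))" for Q :: "nat \<Rightarrow> bool"
    by (auto simp: Suc_le_eq gr0_conv_Suc)
  show ?thesis
    unfolding self_similar_solution_def dyadic_solution_def wavenumber_def zero
    by (subst shift) (simp only: diff_Suc_1 ode)
qed

lemma shifted_profile_solution:
  assumes "0 < x" "0 < m" "0 < t\<^sub>0"
  shows "self_similar_solution t\<^sub>0 (shifted_profile m x)"
proof -
  let ?a = "shifted_profile m x"
  have "2 ^ Suc n * ?a (Suc n) * ?a (n + 2) = ?a (Suc n) + 2 ^ n * (?a n)\<^sup>2" for n
  proof -
    \<comment> \<open>The case \<open>Suc n = m\<close> holds because entry \<open>1\<close> of the
      profile is \<open>1\<close>; only \<open>m \<le> n\<close> uses the recursion.\<close>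
    consider "Suc n < m" | "Suc n = m" | "m \<le> n" by linarith
    then show ?thesis
    proof cases
      case 3
      then obtain j where "n = m + j" using le_Suc_ex by blast
      moreover have "0 < profile x (Suc j)" using profile_pos[OF \<open>0 < x\<close>] .
      ultimately show ?thesis
        by (simp add: shifted_profile_def field_simps power_add power2_eq_square)
    qed (auto simp: shifted_profile_def)
  qed
  then show ?thesis
    using assms by (simp add: self_similar_solution_iff shifted_profile_def)
qed

text \<open>Once \<open>a m\<close> is fixed, the equation just before it determines the next entry,
  and positivity allows each later equation to be solved for its highest entry.\<close>

lemma self_similar_solution_imp_shifted_profile:
  assumes "0 < t\<^sub>0" and sol: "self_similar_solution t\<^sub>0 a"
    and zero: "\<And>n. 1 \<le> n \<Longrightarrow> n < m \<Longrightarrow> a n = 0" and "0 < m" "0 < a m"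
  shows "a = shifted_profile m (2 ^ m * a m)"
proof -
  let ?x = "2 ^ m * a m"
  have a0: "a 0 = 0" and rec: "2 ^ Suc n * a (Suc n) * a (n + 2) = a (Suc n) + 2 ^ n * (a n)\<^sup>2" for n
    using sol \<open>0 < t\<^sub>0\<close> by (auto simp: self_similar_solution_iff)
  have eq: "2 ^ m * a (m + j) = profile ?x j" for j
  proof (induction j rule: induct_nat_012)
    case 1
    obtain n where n: "m = Suc n" using \<open>0 < m\<close> by (cases m) auto
    \<comment> \<open>For \<open>m = 1\<close> the preceding entry is \<open>a 0\<close>, which
      vanishes by the boundary condition.\<close>
    have "a n = 0" using zero[of n] a0 n by (cases n) auto
    then show ?case using rec[of n] n \<open>0 < a m\<close> by simp
  next
    case (ge2 j)
    have "0 < profile ?x (Suc j)" using \<open>0 < a m\<close> by (intro profile_pos) simp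
    moreover have "2 ^ Suc j * profile ?x (Suc j) * (2 ^ m * a (m + Suc (Suc j))) =
        profile ?x (Suc j) + 2 ^ j * (profile ?x j)\<^sup>2"
    proof -
      have "2 ^ m * (2 ^ Suc (m + j) * a (m + Suc j) * a (m + Suc (Suc j))) =
          2 ^ m * (a (m + Suc j) + 2 ^ (m + j) * (a (m + j))\<^sup>2)"
        using rec[of "m + j"] by simp
      then show ?thesis
        unfolding ge2[symmetric]
        by (simp add: algebra_simps power_add power2_eq_square del: profile.simps)
    qed
    ultimately show ?case
      by (simp add: field_simps)
  qed simp
  show ?thesis
  proof
    show "a n = shifted_profile m ?x n" for n
    proof (cases "n < m")
      case True
      then show ?thesis using zero[of n] a0 by (cases n) (auto simp: shifted_profile_def)
    next
      case False
      then show ?thesis using eq[of "n - m"] by (simp add: shifted_profile_def field_simps)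
    qed
  qed
qed

lemma finite_energy_shifted_profile:
  assumes "0 < m"
  shows "finite_energy (shifted_profile m x) \<longleftrightarrow> summable (\<lambda>j. (profile x j)\<^sup>2)"
proof -
  have "finite_energy (shifted_profile m x) \<longleftrightarrow> summable (\<lambda>n. (shifted_profile m x (n + m))\<^sup>2)"
    unfolding finite_energy_def summable_Suc_iff[of "\<lambda>n. (shifted_profile m x n)\<^sup>2"]
    by (rule summable_iff_shift[symmetric])
  also have "\<dots> \<longleftrightarrow> summable (\<lambda>j. (profile x j)\<^sup>2)"
    by (simp add: shifted_profile_def power_divide)
  finally show ?thesis .
qed

lemma self_similar_blows_up:
  assumes "\<And>n. n\<^sub>0 < n \<Longrightarrow> a n \<noteq> 0"
  shows "blows_up n\<^sub>0 t\<^sub>0 (self_similar t\<^sub>0 a)"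
  unfolding blows_up_def
proof (intro allI impI)
  fix n assume "n\<^sub>0 < n"
  then have "a n \<noteq> 0" by (rule assms)
  have "filterlim (\<lambda>t. t - t\<^sub>0) (at 0) (at_left t\<^sub>0)"
    by (auto simp: filterlim_at eventually_at_filter intro!: tendsto_eq_intros)
  then have "filterlim (\<lambda>t. a n / (t - t\<^sub>0)) at_infinity (at_left t\<^sub>0)"
    using \<open>a n \<noteq> 0\<close> by (intro filterlim_divide_at_infinity[of _ "a n"]) auto
  then show "filterlim (\<lambda>t. \<bar>self_similar t\<^sub>0 a n t\<bar>) at_top (at_left t\<^sub>0)"
    using filterlim_at_infinity_imp_norm_at_top by (force simp: self_similar_def)
qed

theorem corollary12:
  fixes t\<^sub>0 :: real and n\<^sub>0 :: nat
  assumes "t\<^sub>0 > 0"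
  defines "P \<equiv> \<lambda>a :: nat \<Rightarrow> real.
    self_similar_solution t\<^sub>0 a \<and> negative t\<^sub>0 (self_similar t\<^sub>0 a) \<and> finite_energy a \<and>
    (\<forall>n\<in>{1..n\<^sub>0}. a n = 0) \<and> a (n\<^sub>0 + 1) \<noteq> 0"
  shows "(\<exists>!a. P a) \<and> (\<forall>a. P a \<longrightarrow> blows_up n\<^sub>0 t\<^sub>0 (self_similar t\<^sub>0 a))"
proof -
  let ?m = "Suc n\<^sub>0"
  \<comment> \<open>This reduces existence and uniqueness to the parameter \<open>x\<close>.
    Negativity at time \<open>0\<close> together with \<open>a ?m\<close> being nonzero makes
    \<open>a ?m\<close> positive.\<close>
  have P_iff: "P a \<longleftrightarrow> (\<exists>x>0. summable (\<lambda>j. (profile x j)\<^sup>2) \<and> a = shifted_profile ?m x)" for a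
  proof
    assume a: "P a"
    have "a ?m / (0 - t\<^sub>0) \<le> 0"
      using a \<open>t\<^sub>0 > 0\<close> by (force simp: P_def negative_def self_similar_def)
    then have "0 < a ?m"
      using a \<open>t\<^sub>0 > 0\<close> by (auto simp: P_def zero_le_divide_iff)
    moreover from this have "a = shifted_profile ?m (2 ^ ?m * a ?m)"
      using a \<open>t\<^sub>0 > 0\<close> by (intro self_similar_solution_imp_shifted_profile[of t\<^sub>0]) (auto simp: P_def)
    moreover from this have "summable (\<lambda>j. (profile (2 ^ ?m * a ?m) j)\<^sup>2)"
      using a finite_energy_shifted_profile[of ?m] by (metis P_def zero_less_Suc)
    ultimately show "\<exists>x>0. summable (\<lambda>j. (profile x j)\<^sup>2) \<and> a = shifted_profile ?m x"
      by (intro exI[of _ "2 ^ ?m * a ?m"]) auto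
  next
    assume "\<exists>x>0. summable (\<lambda>j. (profile x j)\<^sup>2) \<and> a = shifted_profile ?m x"
    then obtain x where "0 < x" "summable (\<lambda>j. (profile x j)\<^sup>2)" and a: "a = shifted_profile ?m x"
      by blast
    moreover have "0 \<le> a n" for n
      using profile_pos[OF \<open>0 < x\<close>] by (simp add: a shifted_profile_def less_imp_le)
    then have "negative t\<^sub>0 (self_similar t\<^sub>0 a)"
      by (simp add: negative_def self_similar_def divide_nonneg_neg)
    ultimately show "P a"
      using \<open>t\<^sub>0 > 0\<close> shifted_profile_solution[of x ?m t\<^sub>0] finite_energy_shifted_profile[of ?m x]
      by (auto simp: P_def shifted_profile_def)
  qed
  have "\<exists>!a. P a"
  proof (rule ex_ex1I)
    show "\<exists>a. P a" using summable_profile_exists P_iff by blast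
    show "a = b" if "P a" "P b" for a b
      using that profile_summable_imp_le unfolding P_iff by (metis order_antisym)
  qed
  moreover have "blows_up n\<^sub>0 t\<^sub>0 (self_similar t\<^sub>0 a)" if "P a" for a
  proof (rule self_similar_blows_up)
    obtain x where "0 < x" and a: "a = shifted_profile ?m x" using \<open>P a\<close> P_iff by blast
    show "a n \<noteq> 0" if "n\<^sub>0 < n" for n
      using that profile_pos[OF \<open>0 < x\<close>, of "n - ?m"] by (simp add: a shifted_profile_def)
  qed
  ultimately show ?thesis by blast
qed

end
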